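(* Let $L:A\to\mathbb R$ be a positive semidefinite linear functional with $L(1)=1$. For $a\in A$ put $$C_a=\sup_{n\in\mathbb N}\sqrt[2n]{L(a^{2n})},\qquad D_a=\sup_{x\in A,\,L(x^2)\ne 0}\frac{L(ax^2)}{L(x^2)},\qquad d_a=\inf_{x\in A,\,L(x^2)\ne 0}\frac{L(ax^2)}{L(x^2)}.$$ Then $C_a<\infty$ for all $a\in A$ if and only if $D_a<\infty$ and $d_a>-\infty$ for all $a\in A$. Moreover, for every $a\in A$ we have $-C_a\le d_a\le D_a\le C_a$ and at least one of the equalities $C_a=D_a$ or $-C_a=d_a$ is true.
   Context: $A$ is a unital commutative $\mathbb R$-algebra such that the set $X(A)$ of all (unital) $\mathbb R$-algebra homomorphisms $A\to\mathbb R$ is non-empty. $\mathbb N=\{1,2,\dots\}$. A linear functional $L:A\to\mathbb R$ is positive semidefinite if $L(a^2)\ge 0$ for all $a\in A$. Suprema and infima are taken in $[-\infty,\infty]$. *)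

theory Defs
  imports Complex_Main "HOL-Library.Extended_Real"
begin

definition is_character :: "('a::{real_algebra_1,comm_ring_1} \<Rightarrow> real) \<Rightarrow> bool"
  where "is_character \<phi> \<longleftrightarrow>
    linear \<phi> \<and> (\<forall>a b. \<phi> (a * b) = \<phi> a * \<phi> b) \<and> \<phi> 1 = 1"

definition characters :: "('a::{real_algebra_1,comm_ring_1} \<Rightarrow> real) set"
  where "characters = {\<phi>. is_character \<phi>}"

definition positive_semidefinite :: "('a::{real_algebra_1,comm_ring_1} \<Rightarrow> real) \<Rightarrow> bool"
  where "positive_semidefinite L \<longleftrightarrow> (\<forall>a. L (a ^ 2) \<ge> 0)"

definition C_bound :: "('a::{real_algebra_1,comm_ring_1} \<Rightarrow> real) \<Rightarrow> 'a \<Rightarrow> ereal"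
  where "C_bound L a = (SUP n\<in>{1::nat..}. ereal (root (2 * n) (L (a ^ (2 * n)))))"

definition D_bound :: "('a::{real_algebra_1,comm_ring_1} \<Rightarrow> real) \<Rightarrow> 'a \<Rightarrow> ereal"
  where "D_bound L a = (SUP x\<in>{x. L (x ^ 2) \<noteq> 0}. ereal (L (a * x ^ 2) / L (x ^ 2)))"

definition d_bound :: "('a::{real_algebra_1,comm_ring_1} \<Rightarrow> real) \<Rightarrow> 'a \<Rightarrow> ereal"
  where "d_bound L a = (INF x\<in>{x. L (x ^ 2) \<noteq> 0}. ereal (L (a * x ^ 2) / L (x ^ 2)))"

end

theory Submission
  imports Defs
begin

text \<open>
  The pairing \<open>L (x * y)\<close> is a semi-inner product on the algebra, and multiplication by \<open>a\<close> is a
  symmetric operator for it. Then \<open>D_bound L a\<close> and \<open>d_bound L a\<close> are the two ends of its numerical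
  range, while \<open>C_bound L a\<close> is the supremum of the \<open>L\<close>-means of \<open>a\<close>, as an \<open>L\<^sup>\<infinity>\<close>-norm is the
  supremum of the \<open>L\<^sup>p\<close>-norms over a probability space. The whole theorem is the single identity
  \<open>C_bound L a = max (D_bound L a) (- d_bound L a)\<close>, that is, norm equals numerical radius; it holds
  for each \<open>a\<close> separately, also when a side is infinite.

  For \<open>\<le>\<close>: a bound \<open>M\<close> on the numerical radius gives \<open>L (a\<^sup>2 * x\<^sup>2) \<le> M\<^sup>2 * L (x\<^sup>2)\<close> by polarization
  (lemma \<open>polarization_bound\<close>), and iterating this from \<open>x = 1\<close> gives \<open>L (a ^ (2 * n)) \<le> M ^ (2 * n)\<close>.

  For \<open>\<ge>\<close>: let \<open>q = L (a * x\<^sup>2) / L (x\<^sup>2)\<close>. Repeated Cauchy--Schwarz bounds \<open>\<bar>q\<bar>\<close> raised to the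
  power \<open>2 ^ k\<close> by \<open>L (a ^ 2 ^ k * x\<^sup>2) / L (x\<^sup>2)\<close>, and one further application separates \<open>a\<close> from
  \<open>x\<close>, leaving \<open>K * C ^ 2 ^ k\<close> with \<open>K\<close> independent of \<open>k\<close>. The constant disappears after taking
  roots and letting \<open>k\<close> grow.
\<close>

locale positive_functional =
  fixes L :: "'a::{real_algebra_1,comm_ring_1} \<Rightarrow> real"
  assumes linear: "linear L"
    and nonneg: "L (x\<^sup>2) \<ge> 0"
    and unital: "L 1 = 1"
begin

lemmas linear_simps =
  linear_add[OF linear] linear_diff[OF linear] linear_scale[OF linear] linear_0[OF linear]

section \<open>The semi-inner product\<close>

lemma Cauchy_Schwarz: "(L (x * y))\<^sup>2 \<le> L (x\<^sup>2) * L (y\<^sup>2)"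
proof -
  have form: "s\<^sup>2 * L (x\<^sup>2) + 2 * s * t * L (x * y) + t\<^sup>2 * L (y\<^sup>2) \<ge> 0" for s t
  proof -
    have "(s *\<^sub>R x + t *\<^sub>R y)\<^sup>2 = s\<^sup>2 *\<^sub>R x\<^sup>2 + (2 * s * t) *\<^sub>R (x * y) + t\<^sup>2 *\<^sub>R y\<^sup>2"
      by (simp add: scaleR_conv_of_real power2_eq_square algebra_simps)
    then show ?thesis
      using nonneg[of "s *\<^sub>R x + t *\<^sub>R y"] by (simp add: linear_simps)
  qed
  show ?thesis
  proof (cases "L (y\<^sup>2) = 0")
    case True
    have "L (x * y) = 0"
    proof (rule ccontr)
      assume "L (x * y) \<noteq> 0"
      \<comment> \<open>The form is affine in \<open>t\<close>; this \<open>t\<close> gives it the value \<open>-1\<close>.\<close>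
      then show False
        using form[of 1 "- (L (x\<^sup>2) + 1) / (2 * L (x * y))"] True by (simp add: field_simps)
    qed
    then show ?thesis
      by (simp add: True)
  next
    case False
    then have pos: "L (y\<^sup>2) > 0"
      using nonneg[of y] by simp
    have "L (y\<^sup>2) * (L (x\<^sup>2) * L (y\<^sup>2) - (L (x * y))\<^sup>2) \<ge> 0"
      using form[of "L (y\<^sup>2)" "- L (x * y)"] by (simp add: power2_eq_square algebra_simps)
    then show ?thesis
      using pos by (simp add: zero_le_mult_iff)
  qed
qed

lemma Cauchy_Schwarz_weighted: "(L (a * x\<^sup>2))\<^sup>2 \<le> L (a\<^sup>2 * x\<^sup>2) * L (x\<^sup>2)"
  using Cauchy_Schwarz[of "a * x" x] by (simp add: power2_eq_square mult.assoc mult.left_commute)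

section \<open>The means are bounded by the numerical radius\<close>

text \<open>
  A symmetric operator is bounded by its numerical radius: compare the quadratic form of \<open>a\<close> at
  \<open>x + t *\<^sub>R (a * x)\<close> and at \<open>x - t *\<^sub>R (a * x)\<close>. The difference isolates \<open>L (a\<^sup>2 * x\<^sup>2)\<close>, and the
  parallelogram law turns the two bounds into one in terms of \<open>L (x\<^sup>2)\<close>.
\<close>

lemma polarization_bound:
  assumes bound: "\<And>x. \<bar>L (a * x\<^sup>2)\<bar> \<le> M * L (x\<^sup>2)" and "M \<ge> 0"
  shows "L (a\<^sup>2 * x\<^sup>2) \<le> M\<^sup>2 * L (x\<^sup>2)"
proof -
  define N where "N = L (a\<^sup>2 * x\<^sup>2)"
  have main: "2 * t * N \<le> M * (L (x\<^sup>2) + t\<^sup>2 * N)" for t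
  proof -
    define u where "u = x + t *\<^sub>R (a * x)"
    define v where "v = x - t *\<^sub>R (a * x)"
    have "a * u\<^sup>2 - a * v\<^sup>2 = (4 * t) *\<^sub>R (a\<^sup>2 * x\<^sup>2)"
      by (simp add: u_def v_def scaleR_conv_of_real power2_eq_square algebra_simps)
    then have "L (a * u\<^sup>2) - L (a * v\<^sup>2) = 4 * t * N"
      unfolding N_def by (metis linear_simps(2,3) real_scaleR_def)
    moreover have "u\<^sup>2 + v\<^sup>2 = 2 *\<^sub>R x\<^sup>2 + (2 * t\<^sup>2) *\<^sub>R (a\<^sup>2 * x\<^sup>2)"
      by (simp add: u_def v_def scaleR_conv_of_real power2_eq_square algebra_simps)
    then have "L (u\<^sup>2) + L (v\<^sup>2) = 2 * L (x\<^sup>2) + 2 * t\<^sup>2 * N"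
      unfolding N_def by (metis linear_simps(1,3) real_scaleR_def)
    then have "M * L (u\<^sup>2) + M * L (v\<^sup>2) = M * (2 * L (x\<^sup>2) + 2 * t\<^sup>2 * N)"
      by (metis distrib_left)
    ultimately show ?thesis
      using bound[of u] bound[of v] by (simp add: algebra_simps)
  qed
  show ?thesis
  proof (cases "M = 0")
    case True
    then show ?thesis
      using main[of 1] by (simp add: N_def)
  next
    case False
    then have "M > 0"
      using \<open>M \<ge> 0\<close> by simp
    then show ?thesis
      \<comment> \<open>This \<open>t\<close> maximizes \<open>2 * t - M * t\<^sup>2\<close>, the coefficient of \<open>N\<close> collected on the left.\<close>
      using main[of "1 / M"] by (simp add: N_def field_simps power2_eq_square)
  qed
qed

lemma even_moment_le:
  assumes bound: "\<And>x. \<bar>L (a * x\<^sup>2)\<bar> \<le> M * L (x\<^sup>2)" and "M \<ge> 0"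
  shows "L (a ^ (2 * n)) \<le> M ^ (2 * n)"
proof (induction n)
  case 0
  show ?case
    by (simp add: unital)
next
  case (Suc n)
  have "L (a ^ (2 * Suc n)) = L (a\<^sup>2 * (a ^ n)\<^sup>2)"
    by (simp add: power_mult_distrib power2_eq_square power_add mult_2 mult_2_right mult_ac)
  also have "\<dots> \<le> M\<^sup>2 * L ((a ^ n)\<^sup>2)"
    by (rule polarization_bound[OF assms])
  also have "(a ^ n)\<^sup>2 = a ^ (2 * n)"
    by (metis power_mult mult.commute)
  also have "M\<^sup>2 * L (a ^ (2 * n)) \<le> M\<^sup>2 * M ^ (2 * n)"
    using Suc.IH by (intro mult_left_mono) auto
  finally show ?case
    by (simp add: power_add power2_eq_square mult_ac)
qed

lemma quotient_le_D_bound: "L (x\<^sup>2) \<noteq> 0 \<Longrightarrow> ereal (L (a * x\<^sup>2) / L (x\<^sup>2)) \<le> D_bound L a"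
  unfolding D_bound_def by (rule SUP_upper) simp

lemma d_bound_le_quotient: "L (x\<^sup>2) \<noteq> 0 \<Longrightarrow> d_bound L a \<le> ereal (L (a * x\<^sup>2) / L (x\<^sup>2))"
  unfolding d_bound_def by (rule INF_lower) simp

lemma value_between_bounds: "d_bound L a \<le> ereal (L a)" "ereal (L a) \<le> D_bound L a"
  using d_bound_le_quotient[of 1 a] quotient_le_D_bound[of 1 a] by (simp_all add: unital)

lemma C_bound_le_numerical_radius: "C_bound L a \<le> max (D_bound L a) (- d_bound L a)"
proof (cases "max (D_bound L a) (- d_bound L a)")
  case (real M)
  have upper: "D_bound L a \<le> ereal M" and lower: "- d_bound L a \<le> ereal M"
    by (simp_all flip: real)
  have quotient: "\<bar>L (a * x\<^sup>2) / L (x\<^sup>2)\<bar> \<le> M" if "L (x\<^sup>2) \<noteq> 0" for x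
  proof -
    have "ereal (L (a * x\<^sup>2) / L (x\<^sup>2)) \<le> ereal M"
      using quotient_le_D_bound[OF that] upper by (rule order_trans)
    moreover have "- ereal (L (a * x\<^sup>2) / L (x\<^sup>2)) \<le> ereal M"
      using d_bound_le_quotient[OF that] lower by (metis ereal_minus_le_minus order_trans)
    ultimately show ?thesis
      by simp
  qed
  have "M \<ge> 0"
    using quotient[of 1] by (simp add: unital)
  have bound: "\<bar>L (a * x\<^sup>2)\<bar> \<le> M * L (x\<^sup>2)" for x
  proof (cases "L (x\<^sup>2) = 0")
    case True
    \<comment> \<open>The null vectors of the semi-inner product, which the quotients omit.\<close>
    then show ?thesis
      using Cauchy_Schwarz_weighted[of a x] by simp
  next
    case False
    then have "L (x\<^sup>2) > 0"
      using nonneg[of x] by simp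
    then show ?thesis
      using quotient[OF False] by (simp add: abs_divide pos_divide_le_eq)
  qed
  have "root (2 * n) (L (a ^ (2 * n))) \<le> M" if "n \<ge> 1" for n
    using that even_moment_le[OF bound \<open>M \<ge> 0\<close>, of n] \<open>M \<ge> 0\<close>
    by (metis mult_eq_0_iff not_one_le_zero pos2 real_root_le_mono real_root_power_cancel
        zero_less_iff_neq_zero)
  then show ?thesis
    unfolding real C_bound_def by (intro SUP_least) simp
next
  case PInf
  then show ?thesis
    by simp
next
  case MInf
  then show ?thesis
    using value_between_bounds(2)[of a] by (auto simp: max_def split: if_splits)
qed

section \<open>The numerical radius is bounded by the means\<close>

text \<open>
  Dividing by \<open>L (x\<^sup>2)\<close> turns \<open>b \<mapsto> L (b * x\<^sup>2)\<close> into another normalized positive functional, for which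
  Cauchy--Schwarz against \<open>1\<close> bounds the squared value at \<open>b\<close> by the value at \<open>b\<^sup>2\<close>. Each use
  doubles the exponent; hence the powers of two.
\<close>

lemma iterated_Cauchy_Schwarz:
  assumes "L (x\<^sup>2) > 0"
  shows "\<bar>L (a * x\<^sup>2) / L (x\<^sup>2)\<bar> ^ 2 ^ k \<le> \<bar>L (a ^ 2 ^ k * x\<^sup>2) / L (x\<^sup>2)\<bar>"
proof (induction k)
  case 0
  show ?case
    by simp
next
  case (Suc k)
  define b where "b = a ^ 2 ^ k"
  have "\<bar>L (a * x\<^sup>2) / L (x\<^sup>2)\<bar> ^ 2 ^ Suc k = (\<bar>L (a * x\<^sup>2) / L (x\<^sup>2)\<bar> ^ 2 ^ k)\<^sup>2"
    by (simp add: power_mult mult.commute flip: power_mult)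
  also have "\<dots> \<le> \<bar>L (b * x\<^sup>2) / L (x\<^sup>2)\<bar>\<^sup>2"
    unfolding b_def by (intro power_mono Suc.IH) simp
  also have "\<dots> = (L (b * x\<^sup>2))\<^sup>2 / (L (x\<^sup>2))\<^sup>2"
    by (simp add: power_divide)
  also have "\<dots> \<le> L (b\<^sup>2 * x\<^sup>2) * L (x\<^sup>2) / (L (x\<^sup>2))\<^sup>2"
    by (intro divide_right_mono Cauchy_Schwarz_weighted) simp
  also have "\<dots> = L (b\<^sup>2 * x\<^sup>2) / L (x\<^sup>2)"
    using assms by (simp add: power2_eq_square)
  also have "b\<^sup>2 = a ^ 2 ^ Suc k"
    by (simp add: b_def mult.commute flip: power_mult)
  finally show ?case
    by linarith
qed

end

text \<open>If \<open>r / C > 1\<close>, then its powers would outgrow \<open>K\<close>.\<close>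

lemma le_if_powers_le_const_mult:
  fixes r C K :: real
  assumes powers: "\<And>k. r ^ 2 ^ k \<le> K * C ^ 2 ^ k" and "C \<ge> 0"
  shows "r \<le> C"
proof (rule ccontr)
  assume "\<not> r \<le> C"
  then have "r > C" "r > 0"
    using \<open>C \<ge> 0\<close> by auto
  show False
  proof (cases "C = 0")
    case True
    then show ?thesis
      using powers[of 0] \<open>r > 0\<close> by simp
  next
    case False
    then have "C > 0"
      using \<open>C \<ge> 0\<close> by simp
    then have "r / C > 1"
      using \<open>r > C\<close> by simp
    then obtain n where "K < (r / C) ^ n"
      using real_arch_pow by blast
    also have "\<dots> \<le> (r / C) ^ 2 ^ n"
      using \<open>r / C > 1\<close> by (intro power_increasing) (auto intro: less_imp_le)
    also have "\<dots> \<le> K"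
      using powers[of n] \<open>C > 0\<close> by (simp add: power_divide pos_divide_le_eq)
    finally show False
      by simp
  qed
qed

context positive_functional
begin

lemma even_moment_nonneg: "L (a ^ (2 * n)) \<ge> 0"
  using nonneg[of "a ^ n"] by (metis power_mult mult.commute)

lemma root_le_C_bound: "n \<ge> 1 \<Longrightarrow> ereal (root (2 * n) (L (a ^ (2 * n)))) \<le> C_bound L a"
  unfolding C_bound_def by (rule SUP_upper) simp

lemma C_bound_nonneg: "C_bound L a \<ge> 0"
proof -
  have "0 \<le> ereal (root (2 * 1) (L (a ^ (2 * 1))))"
    using even_moment_nonneg[of a 1] by simp
  also have "\<dots> \<le> C_bound L a"
    by (rule root_le_C_bound) simp
  finally show ?thesis .
qed

lemma quotient_le_C_bound:
  assumes "L (x\<^sup>2) \<noteq> 0"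
  shows "ereal \<bar>L (a * x\<^sup>2) / L (x\<^sup>2)\<bar> \<le> C_bound L a"
proof (cases "C_bound L a")
  case (real C)
  have "C \<ge> 0"
    using C_bound_nonneg[of a] by (simp add: real)
  have pos: "L (x\<^sup>2) > 0"
    using assms nonneg[of x] by simp
  define K where "K = sqrt (L ((x\<^sup>2)\<^sup>2)) / L (x\<^sup>2)"
  have moment: "L ((a ^ n)\<^sup>2) \<le> (C ^ n)\<^sup>2" if "n \<ge> 1" for n
  proof -
    have "root (2 * n) (L (a ^ (2 * n))) \<le> C"
      using root_le_C_bound[OF that, of a] by (simp add: real)
    then have "root (2 * n) (L (a ^ (2 * n))) ^ (2 * n) \<le> C ^ (2 * n)"
      by (rule power_mono) (use even_moment_nonneg that in auto)
    moreover have "root (2 * n) (L (a ^ (2 * n))) ^ (2 * n) = L (a ^ (2 * n))"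
      using that even_moment_nonneg by (intro real_root_pow_pos2) auto
    ultimately show ?thesis
      by (simp add: mult.commute flip: power_mult)
  qed
  have "\<bar>L (a * x\<^sup>2) / L (x\<^sup>2)\<bar> ^ 2 ^ k \<le> K * C ^ 2 ^ k" for k
  proof -
    define n :: nat where "n = 2 ^ k"
    have "(L (a ^ n * x\<^sup>2))\<^sup>2 \<le> L ((a ^ n)\<^sup>2) * L ((x\<^sup>2)\<^sup>2)"
      by (rule Cauchy_Schwarz)
    also have "\<dots> \<le> (C ^ n)\<^sup>2 * L ((x\<^sup>2)\<^sup>2)"
      by (intro mult_right_mono moment nonneg) (simp add: n_def)
    finally have "\<bar>L (a ^ n * x\<^sup>2)\<bar> \<le> sqrt ((C ^ n)\<^sup>2 * L ((x\<^sup>2)\<^sup>2))"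
      using real_le_rsqrt by fastforce
    also have "\<dots> = C ^ n * sqrt (L ((x\<^sup>2)\<^sup>2))"
      using \<open>C \<ge> 0\<close> by (simp add: real_sqrt_mult)
    finally have "\<bar>L (a ^ n * x\<^sup>2) / L (x\<^sup>2)\<bar> \<le> K * C ^ n"
      using pos by (simp add: K_def abs_divide divide_right_mono mult.commute)
    then show ?thesis
      using iterated_Cauchy_Schwarz[OF pos, of a k] by (simp add: n_def)
  qed
  then have "\<bar>L (a * x\<^sup>2) / L (x\<^sup>2)\<bar> \<le> C"
    using \<open>C \<ge> 0\<close> by (rule le_if_powers_le_const_mult)
  then show ?thesis
    by (simp add: real)
qed (use C_bound_nonneg[of a] in auto)

lemma D_bound_le_C_bound: "D_bound L a \<le> C_bound L a"
  unfolding D_bound_def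
proof (rule SUP_least)
  fix x assume "x \<in> {x. L (x\<^sup>2) \<noteq> 0}"
  then have "ereal \<bar>L (a * x\<^sup>2) / L (x\<^sup>2)\<bar> \<le> C_bound L a"
    using quotient_le_C_bound by blast
  then show "ereal (L (a * x\<^sup>2) / L (x\<^sup>2)) \<le> C_bound L a"
    by (rule order_trans[rotated]) (simp only: ereal_less_eq abs_ge_self)
qed

lemma minus_C_bound_le_d_bound: "- C_bound L a \<le> d_bound L a"
  unfolding d_bound_def
proof (rule INF_greatest)
  fix x assume "x \<in> {x. L (x\<^sup>2) \<noteq> 0}"
  then have "ereal \<bar>L (a * x\<^sup>2) / L (x\<^sup>2)\<bar> \<le> C_bound L a"
    using quotient_le_C_bound by blast
  moreover have "ereal (- (L (a * x\<^sup>2) / L (x\<^sup>2))) \<le> ereal \<bar>L (a * x\<^sup>2) / L (x\<^sup>2)\<bar>"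
    by (simp only: ereal_less_eq abs_ge_minus_self)
  ultimately show "- C_bound L a \<le> ereal (L (a * x\<^sup>2) / L (x\<^sup>2))"
    by (metis ereal_uminus_le_reorder order_trans uminus_ereal.simps(1))
qed

section \<open>Norm equals numerical radius\<close>

lemma C_bound_eq_numerical_radius: "C_bound L a = max (D_bound L a) (- d_bound L a)"
proof (rule antisym[OF C_bound_le_numerical_radius])
  show "max (D_bound L a) (- d_bound L a) \<le> C_bound L a"
    using D_bound_le_C_bound minus_C_bound_le_d_bound by (simp add: ereal_uminus_le_reorder)
qed

end

theorem theorem3p6:
  fixes L :: "'a::{real_algebra_1,comm_ring_1} \<Rightarrow> real"
  assumes "(characters :: ('a \<Rightarrow> real) set) \<noteq> {}"
    and "linear L"
    and "positive_semidefinite L"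
    and "L 1 = 1"
  shows "((\<forall>a. C_bound L a < \<infinity>) \<longleftrightarrow> (\<forall>a. D_bound L a < \<infinity> \<and> d_bound L a > - \<infinity>)) \<and>
    (\<forall>a. - C_bound L a \<le> d_bound L a \<and> d_bound L a \<le> D_bound L a \<and> D_bound L a \<le> C_bound L a \<and>
         (C_bound L a = D_bound L a \<or> - C_bound L a = d_bound L a))"
proof -
  interpret positive_functional L
    using assms(2-4) by (intro positive_functional.intro) (simp_all add: positive_semidefinite_def)
  have "C_bound L a < \<infinity> \<longleftrightarrow> D_bound L a < \<infinity> \<and> d_bound L a > - \<infinity>" for a
    unfolding C_bound_eq_numerical_radius by (cases "d_bound L a") (auto simp: max_def split: if_splits)
  moreover have "C_bound L a = D_bound L a \<or> - C_bound L a = d_bound L a" for a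
    unfolding C_bound_eq_numerical_radius by (auto simp: max_def)
  moreover have "d_bound L a \<le> D_bound L a" for a
    using value_between_bounds[of a] by (rule order_trans)
  ultimately show ?thesis
    using D_bound_le_C_bound minus_C_bound_le_d_bound by auto
qed

end
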